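(* Let $M$ be a finite MDP with trajectory space $\Xi$, feature map $\phi:\mathcal{S}\times\mathcal{A}\to\mathbb{R}^d$ and ground-truth reward parameter $w^\star\in\mathbb{R}^d$. Let $\Xi^\star\subseteq\Xi$ denote the trajectories that are optimal under $w^\star$. Define \[ H_{\text{comparison}}=\{w\in\mathbb{R}^d:\|w\|_2\le 1,\ w^\top(\Phi(\xi_i)-\Phi(\xi_j))\ge 0\ \ \forall\,\xi_i,\xi_j\in\Xi\text{ with }w^{\star\top}\Phi(\xi_i)>w^{\star\top}\Phi(\xi_j)\}, \] \[ H_{\text{demo}}=\{w\in\mathbb{R}^d:\|w\|_2\le 1,\ w^\top(\Phi(\xi^\star)-\Phi(\xi'))\ge 0\ \ \forall\,\xi^\star\in\Xi^\star,\ \forall\,\xi'\in\Xi\text{ with the same initial state as }\xi^\star\}. \] Assume (genericity) that there exist $\xi_i,\xi_j\in\Xi$ with $w^{\star\top}\Phi(\xi_i)>w^{\star\top}\Phi(\xi_j)$ such that the set $H_{\text{demo}}\cap\{w: w^\top(\Phi(\xi_i)-\Phi(\xi_j))<0\}$ has positive Lebesgue measure. Then \[ H_{\text{comparison}}\subsetneq H_{\text{demo}}\quad\text{and}\quad G(H_{\text{comparison}})<G(H_{\text{demo}}). \]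
   Context: A finite MDP (without reward) is a tuple $(\mathcal{S},\mathcal{A},T,\gamma)$ with finite $\mathcal{S},\mathcal{A}$, transition function $T(s'\mid s,a)$ and $\gamma\in(0,1)$. $\Xi$ is the set of all trajectories $\xi=(s_0,a_0,s_1,a_1,\dots)$ that can arise in $M$, and $\Phi(\xi)=\sum_{t=0}^{\infty}\gamma^t\phi(s_t,a_t)\in\mathbb{R}^d$ is the discounted feature vector; the return of $\xi$ under reward parameter $w$ is $w^\top\Phi(\xi)$. A trajectory $\xi^\star\in\Xi$ is optimal under $w^\star$ if $w^{\star\top}\Phi(\xi^\star)\ge w^{\star\top}\Phi(\xi')$ for every $\xi'\in\Xi$ with the same initial state. For a set $H$ contained in the unit ball of $\mathbb{R}^d$, $G(H)$ denotes its volume ($d$-dimensional Lebesgue measure). *)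

theory Defs
  imports "HOL-Analysis.Analysis" "HOL-Probability.Probability_Mass_Function"
begin

text \<open>
  A finite MDP without reward is given by a transition kernel over finite types of states and
  actions together with a discount factor. It carries no initial distribution, so a trajectory
  may start in any state.
\<close>

type_synonym ('s, 'a) trajectory = "nat \<Rightarrow> 's \<times> 'a"

definition trajectories ::
    "('s::finite \<Rightarrow> 'a::finite \<Rightarrow> 's pmf) \<Rightarrow> ('s, 'a) trajectory set" where
  "trajectories T =
     {\<xi>. \<forall>t. pmf (T (fst (\<xi> t)) (snd (\<xi> t))) (fst (\<xi> (Suc t))) > 0}"

definition initial_state :: "('s, 'a) trajectory \<Rightarrow> 's" where
  "initial_state \<xi> = fst (\<xi> 0)"

text \<open>The series converges for every trajectory when \<open>0 < \<gamma> < 1\<close>, as \<open>\<phi>\<close> has finite range.\<close>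

definition discounted_features ::
    "real \<Rightarrow> ('s::finite \<Rightarrow> 'a::finite \<Rightarrow> real ^ 'd) \<Rightarrow> ('s, 'a) trajectory \<Rightarrow> real ^ 'd" where
  "discounted_features \<gamma> \<phi> \<xi> = (\<Sum>t. \<gamma> ^ t *\<^sub>R \<phi> (fst (\<xi> t)) (snd (\<xi> t)))"

definition optimal_trajectories ::
    "('s::finite \<Rightarrow> 'a::finite \<Rightarrow> 's pmf) \<Rightarrow> real \<Rightarrow> ('s \<Rightarrow> 'a \<Rightarrow> real ^ 'd) \<Rightarrow> real ^ 'd
      \<Rightarrow> ('s, 'a) trajectory set" where
  "optimal_trajectories T \<gamma> \<phi> w =
     {\<xi> \<in> trajectories T. \<forall>\<xi>' \<in> trajectories T. initial_state \<xi>' = initial_state \<xi> \<longrightarrow>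
        w \<bullet> discounted_features \<gamma> \<phi> \<xi> \<ge> w \<bullet> discounted_features \<gamma> \<phi> \<xi>'}"

definition H_comparison ::
    "('s::finite \<Rightarrow> 'a::finite \<Rightarrow> 's pmf) \<Rightarrow> real \<Rightarrow> ('s \<Rightarrow> 'a \<Rightarrow> real ^ 'd) \<Rightarrow> real ^ 'd
      \<Rightarrow> (real ^ 'd) set" where
  "H_comparison T \<gamma> \<phi> wstar =
     {w. norm w \<le> 1 \<and>
        (\<forall>\<xi>\<^sub>i \<in> trajectories T. \<forall>\<xi>\<^sub>j \<in> trajectories T.
           wstar \<bullet> discounted_features \<gamma> \<phi> \<xi>\<^sub>i > wstar \<bullet> discounted_features \<gamma> \<phi> \<xi>\<^sub>j \<longrightarrow>
           w \<bullet> (discounted_features \<gamma> \<phi> \<xi>\<^sub>i - discounted_features \<gamma> \<phi> \<xi>\<^sub>j) \<ge> 0)}"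

definition H_demo ::
    "('s::finite \<Rightarrow> 'a::finite \<Rightarrow> 's pmf) \<Rightarrow> real \<Rightarrow> ('s \<Rightarrow> 'a \<Rightarrow> real ^ 'd) \<Rightarrow> real ^ 'd
      \<Rightarrow> (real ^ 'd) set" where
  "H_demo T \<gamma> \<phi> wstar =
     {w. norm w \<le> 1 \<and>
        (\<forall>\<xi>\<^sub>o \<in> optimal_trajectories T \<gamma> \<phi> wstar. \<forall>\<xi>' \<in> trajectories T.
           initial_state \<xi>' = initial_state \<xi>\<^sub>o \<longrightarrow>
           w \<bullet> (discounted_features \<gamma> \<phi> \<xi>\<^sub>o - discounted_features \<gamma> \<phi> \<xi>') \<ge> 0)}"

text \<open>
  Only applied to Borel subsets of the unit ball; there the real-valued measure is the true
  volume (it would be 0 on sets of infinite measure and on non-measurable sets).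
\<close>

definition G :: "(real ^ 'd) set \<Rightarrow> real" where
  "G H = measure lebesgue H"

end

theory Submission
  imports Defs
begin

text \<open>
  An optimal trajectory may tie with another one from the same state, and comparisons say nothing
  about ties. But then both trajectories are optimal, so \<open>H_demo\<close> lies in the hyperplane orthogonal
  to the difference of their features; as it is not a null set, this difference is zero. Hence every
  demonstration constraint is trivial or a comparison constraint. The violated comparison then cuts
  off a part of positive volume.
\<close>

text \<open>There may be uncountably many trajectories, so measurability is obtained through
  topology: both sets are intersections of the closed unit ball with closed half-spaces (or the
  whole space), since the premises of the constraints do not involve \<open>w\<close>. Being also
  bounded, they are compact.\<close>

lemma closed_H_comparison: "closed (H_comparison T \<gamma> \<phi> wstar)"
  unfolding H_comparison_def Ball_def
  by (intro closed_Collect_conj closed_Collect_all closed_Collect_imp closed_Collect_le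
      continuous_intros open_Collect_const)

lemma closed_H_demo: "closed (H_demo T \<gamma> \<phi> wstar)"
  unfolding H_demo_def Ball_def
  by (intro closed_Collect_conj closed_Collect_all closed_Collect_imp closed_Collect_le
      continuous_intros open_Collect_const)

lemma lmeasurable_H_comparison: "H_comparison T \<gamma> \<phi> wstar \<in> lmeasurable"
proof (rule lmeasurable_compact)
  have "bounded (H_comparison T \<gamma> \<phi> wstar)"
    by (rule boundedI[of _ 1]) (simp add: H_comparison_def)
  then show "compact (H_comparison T \<gamma> \<phi> wstar)"
    using closed_H_comparison by (simp add: compact_eq_bounded_closed)
qed

lemma lmeasurable_H_demo: "H_demo T \<gamma> \<phi> wstar \<in> lmeasurable"
proof (rule lmeasurable_compact)
  have "bounded (H_demo T \<gamma> \<phi> wstar)"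
    by (rule boundedI[of _ 1]) (simp add: H_demo_def)
  then show "compact (H_demo T \<gamma> \<phi> wstar)"
    using closed_H_demo by (simp add: compact_eq_bounded_closed)
qed

text \<open>This is the only place where positive volume serves the inclusion: it handles the
  demonstration constraints that have no strict comparison behind them.\<close>

lemma tied_optimal_features_eq:
  assumes nonnull: "\<not> negligible (H_demo T \<gamma> \<phi> wstar)"
    and opt: "\<xi> \<in> optimal_trajectories T \<gamma> \<phi> wstar"
    and traj: "\<xi>' \<in> trajectories T" and init: "initial_state \<xi>' = initial_state \<xi>"
    and tie: "wstar \<bullet> discounted_features \<gamma> \<phi> \<xi>' = wstar \<bullet> discounted_features \<gamma> \<phi> \<xi>"
  shows "discounted_features \<gamma> \<phi> \<xi>' = discounted_features \<gamma> \<phi> \<xi>"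
proof (rule ccontr)
  let ?v = "discounted_features \<gamma> \<phi> \<xi> - discounted_features \<gamma> \<phi> \<xi>'"
  assume "discounted_features \<gamma> \<phi> \<xi>' \<noteq> discounted_features \<gamma> \<phi> \<xi>"
  then have "negligible {w. ?v \<bullet> w = 0}"
    by (intro negligible_hyperplane) simp
  \<comment> \<open>Optimality depends only on the initial state and the return under
    \<open>wstar\<close>, so it passes to \<open>\<xi>'\<close>. Each of the two trajectories now
    acts as a demonstration against the other, and the two opposite inequalities force
    equality.\<close>
  moreover have opt': "\<xi>' \<in> optimal_trajectories T \<gamma> \<phi> wstar"
    using opt traj init tie by (simp add: optimal_trajectories_def)
  have "H_demo T \<gamma> \<phi> wstar \<subseteq> {w. ?v \<bullet> w = 0}"
  proof
    fix w assume w: "w \<in> H_demo T \<gamma> \<phi> wstar"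
    have "\<xi> \<in> trajectories T"
      using opt by (simp add: optimal_trajectories_def)
    then have "w \<bullet> (discounted_features \<gamma> \<phi> \<xi>' - discounted_features \<gamma> \<phi> \<xi>) \<ge> 0"
      using w opt' init by (simp add: H_demo_def)
    moreover have "w \<bullet> ?v \<ge> 0"
      using w opt traj init by (simp add: H_demo_def)
    ultimately show "w \<in> {w. ?v \<bullet> w = 0}"
      by (simp add: inner_diff_right inner_diff_left inner_commute)
  qed
  ultimately show False
    using nonnull negligible_subset by blast
qed

lemma H_comparison_subset_H_demo:
  assumes "\<not> negligible (H_demo T \<gamma> \<phi> wstar)"
  shows "H_comparison T \<gamma> \<phi> wstar \<subseteq> H_demo T \<gamma> \<phi> wstar"
proof
  fix w assume w: "w \<in> H_comparison T \<gamma> \<phi> wstar"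
  have "w \<bullet> (discounted_features \<gamma> \<phi> \<xi> - discounted_features \<gamma> \<phi> \<xi>') \<ge> 0"
    if opt: "\<xi> \<in> optimal_trajectories T \<gamma> \<phi> wstar" and traj: "\<xi>' \<in> trajectories T"
      and init: "initial_state \<xi>' = initial_state \<xi>" for \<xi> \<xi>'
  proof (cases "wstar \<bullet> discounted_features \<gamma> \<phi> \<xi>' = wstar \<bullet> discounted_features \<gamma> \<phi> \<xi>")
    case True
    then show ?thesis
      using tied_optimal_features_eq[OF assms opt traj init] by simp
  next
    case False
    \<comment> \<open>Without a tie, optimality is a strict preference, so this pair is among the
      comparisons that constrain \<open>w\<close>.\<close>
    moreover have "\<xi> \<in> trajectories T"
      "wstar \<bullet> discounted_features \<gamma> \<phi> \<xi> \<ge> wstar \<bullet> discounted_features \<gamma> \<phi> \<xi>'"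
      using opt traj init by (auto simp: optimal_trajectories_def)
    ultimately show ?thesis
      using w traj by (simp add: H_comparison_def)
  qed
  moreover have "norm w \<le> 1"
    using w by (simp add: H_comparison_def)
  ultimately show "w \<in> H_demo T \<gamma> \<phi> wstar"
    by (simp add: H_demo_def)
qed

theorem proposition1:
  fixes T :: "'s::finite \<Rightarrow> 'a::finite \<Rightarrow> 's pmf"
    and \<gamma> :: real
    and \<phi> :: "'s \<Rightarrow> 'a \<Rightarrow> real ^ 'd"
    and wstar :: "real ^ 'd"
  assumes "0 < \<gamma>" and "\<gamma> < 1"
    and "\<exists>\<xi>\<^sub>i \<in> trajectories T. \<exists>\<xi>\<^sub>j \<in> trajectories T.
           wstar \<bullet> discounted_features \<gamma> \<phi> \<xi>\<^sub>i > wstar \<bullet> discounted_features \<gamma> \<phi> \<xi>\<^sub>j \<and>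
           emeasure lebesgue (H_demo T \<gamma> \<phi> wstar \<inter>
             {w. w \<bullet> (discounted_features \<gamma> \<phi> \<xi>\<^sub>i - discounted_features \<gamma> \<phi> \<xi>\<^sub>j) < 0}) > 0"
  shows "H_comparison T \<gamma> \<phi> wstar \<subset> H_demo T \<gamma> \<phi> wstar
       \<and> G (H_comparison T \<gamma> \<phi> wstar) < G (H_demo T \<gamma> \<phi> wstar)"
proof -
  let ?C = "H_comparison T \<gamma> \<phi> wstar" and ?D = "H_demo T \<gamma> \<phi> wstar"
  obtain \<xi>\<^sub>i \<xi>\<^sub>j where traj: "\<xi>\<^sub>i \<in> trajectories T" "\<xi>\<^sub>j \<in> trajectories T"
    and better: "wstar \<bullet> discounted_features \<gamma> \<phi> \<xi>\<^sub>i > wstar \<bullet> discounted_features \<gamma> \<phi> \<xi>\<^sub>j"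
    and pos: "emeasure lebesgue (?D \<inter>
      {w. w \<bullet> (discounted_features \<gamma> \<phi> \<xi>\<^sub>i - discounted_features \<gamma> \<phi> \<xi>\<^sub>j) < 0}) > 0"
    using assms(3) by blast
  \<comment> \<open>\<open>N\<close> is the part of \<open>?D\<close> cut off by the violated
    comparison. It makes \<open>?D\<close> non-negligible, as the inclusion requires, and it also
    bounds the gap \<open>?D - ?C\<close> from below.\<close>
  define N where "N = ?D \<inter> {w. w \<bullet> (discounted_features \<gamma> \<phi> \<xi>\<^sub>i - discounted_features \<gamma> \<phi> \<xi>\<^sub>j) < 0}"
  have N: "\<not> negligible N"
    using pos by (auto simp: N_def negligible_iff_null_sets null_sets_def)
  have "N \<subseteq> ?D"
    by (simp add: N_def)
  then have sub: "?C \<subseteq> ?D"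
    using N by (intro H_comparison_subset_H_demo) (metis negligible_subset)
  have N_diff: "N \<subseteq> ?D - ?C"
  proof
    fix w assume w: "w \<in> N"
    then have "\<not> w \<bullet> (discounted_features \<gamma> \<phi> \<xi>\<^sub>i - discounted_features \<gamma> \<phi> \<xi>\<^sub>j) \<ge> 0"
      by (simp add: N_def)
    then have "w \<notin> ?C"
      using traj better unfolding H_comparison_def by blast
    with w show "w \<in> ?D - ?C"
      by (simp add: N_def)
  qed
  have "\<not> negligible (?D - ?C)"
    using N N_diff by (metis negligible_subset)
  \<comment> \<open>Since \<open>measure\<close> defaults to 0 outside the sets of finite measure,
    the value 0 implies negligibility only once this is known.\<close>
  moreover have "?D - ?C \<in> lmeasurable"
    by (intro fmeasurable_Diff fmeasurableD lmeasurable_H_demo lmeasurable_H_comparison)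
  ultimately have "measure lebesgue (?D - ?C) \<noteq> 0"
    by (simp add: negligible_iff_measure)
  moreover have "measure lebesgue (?D - ?C) = G ?D - G ?C"
    unfolding G_def
    by (rule measurable_measure_Diff[OF lmeasurable_H_demo fmeasurableD[OF lmeasurable_H_comparison] sub])
  ultimately have "G ?C < G ?D"
    using measure_nonneg[of lebesgue "?D - ?C"] by linarith
  \<comment> \<open>The inclusion is proper because equal sets would have equal volumes.\<close>
  with sub show ?thesis
    by auto
qed

end
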